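(* Let $S\neq\mathbb{N}$ be a numerical semigroup, let $a\in S$, and let $T=S+a$ be the dilatation of $S$ with respect to $a$. If $0<s\in S$, then the Apéry set of $T$ with respect to $s+a\in T$ is \[ \mathrm{Ap}(T,s+a)=\{0,\,s+2a\}\cup\{\alpha+a \mid \alpha\in \mathrm{Ap}(S,s)\setminus\{0\}\}\cup\{\beta+s+a \mid \beta\in \mathrm{Ap}(S,a)\setminus\{0\}\}. \]
   Context: $\mathbb{N}$ denotes the nonnegative integers. A numerical semigroup $S$ is a submonoid of $(\mathbb{N},+)$ with $\mathbb{N}\setminus S$ finite. For $a\in S$, the dilatation of $S$ with respect to $a$ is the numerical semigroup $S+a=\{0\}\cup\{s+a : s\in S\setminus\{0\}\}$ (so here $S+a$ is not the full translate of $S$). For a numerical semigroup $S$ and $s\in S$, the Apéry set of $S$ with respect to $s$ is $\mathrm{Ap}(S,s)=\{x\in S : x-s\notin S\}$.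
   Formalization: The formal statement assumes in addition that a ≠ 0; for a = 0 the claimed equality always fails, since then T = S and the right side contains s + 2a = s, while s − s = 0 ∈ S shows s ∉ Ap(T, s). *)

theory Defs
  imports Main
begin

definition numerical_semigroup :: "nat set \<Rightarrow> bool" where
  "numerical_semigroup S \<longleftrightarrow>
     0 \<in> S \<and> (\<forall>x\<in>S. \<forall>y\<in>S. x + y \<in> S) \<and> finite (UNIV - S)"

definition dilatation :: "nat set \<Rightarrow> nat \<Rightarrow> nat set" where
  "dilatation S a = {0} \<union> {s + a | s. s \<in> S - {0}}"

text \<open>The difference \<open>x - s\<close> is taken in the integers, since subtraction on the
  naturals is truncated.\<close>

definition Apery :: "nat set \<Rightarrow> nat \<Rightarrow> nat set" where
  "Apery S s = {x \<in> S. int x - int s \<notin> int ` S}"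

lemma add_in_dilatation: "s \<in> S \<Longrightarrow> 0 < s \<Longrightarrow> s + a \<in> dilatation S a"
  by (auto simp: dilatation_def)

lemma numerical_semigroup_dilatation:
  assumes "numerical_semigroup S" and "a \<in> S"
  shows "numerical_semigroup (dilatation S a)"
proof -
  have "UNIV - dilatation S a \<subseteq> {..a} \<union> (\<lambda>x. x + a) ` (UNIV - S)"
  proof
    fix x assume x: "x \<in> UNIV - dilatation S a"
    show "x \<in> {..a} \<union> (\<lambda>x. x + a) ` (UNIV - S)"
    proof (cases "x \<le> a")
      case False
      then have "x = (x - a) + a" "x - a \<noteq> 0" by auto
      have "x - a \<notin> S"
      proof
        assume "x - a \<in> S"
        then have "(x - a) + a \<in> dilatation S a"
          using \<open>x - a \<noteq> 0\<close> by (intro add_in_dilatation) simp_all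
        with x False show False by simp
      qed
      with \<open>x = (x - a) + a\<close> show ?thesis by blast
    qed simp
  qed
  moreover have "finite ({..a} \<union> (\<lambda>x. x + a) ` (UNIV - S))"
    using assms by (simp add: numerical_semigroup_def)
  ultimately have fin: "finite (UNIV - dilatation S a)"
    by (rule finite_subset)
  have "x + y \<in> dilatation S a" if "x \<in> dilatation S a" "y \<in> dilatation S a" for x y
  proof (cases "x = 0 \<or> y = 0")
    case True
    with that show ?thesis by auto
  next
    case False
    with that obtain u v where uv: "u \<in> S" "v \<in> S" "u \<noteq> 0" "x = u + a" "y = v + a"
      unfolding dilatation_def by auto
    then have "u + v + a \<in> S"
      using assms by (simp add: numerical_semigroup_def)
    then have "(u + v + a) + a \<in> dilatation S a"
      using uv by (intro add_in_dilatation) simp_all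
    then show ?thesis
      using uv by (simp add: ac_simps)
  qed
  with fin show ?thesis
    by (auto simp: numerical_semigroup_def dilatation_def)
qed

end

theory Submission imports Defs begin

text \<open>Every nonzero element of \<open>T\<close> is \<open>u + a\<close> with \<open>u\<close>
  in \<open>S - {0}\<close>, and subtracting \<open>s + a\<close> leaves \<open>u - s\<close>. So
  membership in \<open>Apery T (s + a)\<close> says that \<open>u - s\<close> is neither 0 nor of
  the form \<open>v + a\<close> with \<open>v\<close> in \<open>S - {0}\<close>
  (\<open>add_in_Apery_dilatation_iff\<close>). Either \<open>u - s\<close> is outside
  \<open>S\<close>, which gives the \<alpha> family, or it is a nonzero \<open>w\<close> in
  \<open>S\<close>; then \<open>w = a\<close> gives \<open>s + 2 * a\<close>, and any other
  \<open>w\<close> lies in \<open>Apery S a\<close>.\<close>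

lemma Apery_iff: "x \<in> Apery S s \<longleftrightarrow> x \<in> S \<and> (\<forall>t\<in>S. x \<noteq> t + s)"
  by (auto simp: Apery_def image_iff)

lemma dilatation_iff: "x \<in> dilatation S a \<longleftrightarrow> x = 0 \<or> (\<exists>u\<in>S. u \<noteq> 0 \<and> x = u + a)"
  by (auto simp: dilatation_def)

text \<open>The shift by \<open>a\<close> cancels, so the condition is that \<open>u - s\<close>
  avoids the dilatation; the two conjuncts exclude its zero and its nonzero elements.\<close>

lemma add_in_Apery_dilatation_iff:
  assumes "u \<in> S" "u \<noteq> 0"
  shows "u + a \<in> Apery (dilatation S a) (s + a) \<longleftrightarrow>
    u \<noteq> s \<and> (\<forall>v\<in>S. v \<noteq> 0 \<longrightarrow> u \<noteq> v + a + s)"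
  using assms by (auto simp: Apery_iff dilatation_iff)

theorem proposition2p2:
  fixes S T :: "nat set" and a s :: nat
  assumes "numerical_semigroup S"
    and "S \<noteq> UNIV"
    and "a \<in> S"
    and "a \<noteq> 0"
    and "T = dilatation S a"
    and "s \<in> S"
    and "0 < s"
  shows "Apery T (s + a) =
    {0, s + 2 * a}
    \<union> {\<alpha> + a | \<alpha>. \<alpha> \<in> Apery S s - {0}}
    \<union> {\<beta> + s + a | \<beta>. \<beta> \<in> Apery S a - {0}}"
    (is "_ = ?R")
proof (intro set_eqI iffI)
  have add: "x + y \<in> S" if "x \<in> S" "y \<in> S" for x y
    using assms(1) that by (simp add: numerical_semigroup_def)
  note shift = add_in_Apery_dilatation_iff[of _ S a s, folded assms(5)]
  fix x
  show "x \<in> ?R" if x: "x \<in> Apery T (s + a)"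
  proof (cases "x = 0")
    case False
    then obtain u where u: "u \<in> S" "u \<noteq> 0" "x = u + a"
      using x by (auto simp: Apery_iff assms(5) dilatation_iff)
    then have ne: "u \<noteq> s" "\<And>v. v \<in> S \<Longrightarrow> v \<noteq> 0 \<Longrightarrow> u \<noteq> v + a + s"
      using x shift by blast+
    show ?thesis
    proof (cases "u \<in> Apery S s")
      case True
      then show ?thesis using u by blast
    next
      case False
      then obtain w where w: "w \<in> S" "u = w + s"
        using u by (auto simp: Apery_iff)
      show ?thesis
      proof (cases "w = a")
        case True
        then show ?thesis using u w by simp
      next
        case False
        \<comment> \<open>The exception \<open>w = a\<close> is exactly \<open>t = 0\<close>; a
          nonzero \<open>t\<close> would give \<open>u = t + a + s\<close>.\<close>
        have "w \<noteq> t + a" if "t \<in> S" for t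
          using that w(2) False ne(2)[of t] by (cases "t = 0") simp_all
        then have "w \<in> Apery S a - {0}"
          using w ne(1) by (simp add: Apery_iff)
        then show ?thesis using u w by blast
      qed
    qed
  qed simp
  show "x \<in> Apery T (s + a)" if x: "x \<in> ?R"
  proof -
    consider "x = 0" | "x = (s + a) + a"
      | \<alpha> where "x = \<alpha> + a" "\<alpha> \<in> Apery S s" "\<alpha> \<noteq> 0"
      | \<beta> where "x = (\<beta> + s) + a" "\<beta> \<in> Apery S a" "\<beta> \<noteq> 0"
      using x by auto
    then show ?thesis
    proof cases
      case 1
      then show ?thesis using assms by (simp add: Apery_iff dilatation_iff)
    next
      case 2
      \<comment> \<open>Here \<open>a \<noteq> 0\<close> gives \<open>s + a \<noteq> s\<close>, and
        \<open>s + a = v + a + s\<close> forces \<open>v = 0\<close>.\<close>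
      then show ?thesis using shift[of "s + a"] assms add by auto
    next
      case 3
      moreover have "0 \<in> S" using assms(1) by (simp add: numerical_semigroup_def)
      \<comment> \<open>Both exclusions are instances of \<alpha> \<noteq> \<open>t + s\<close>,
        with \<open>t = 0\<close> and \<open>t = v + a\<close>.\<close>
      ultimately have "\<alpha> \<noteq> s" "\<alpha> \<in> S" "\<And>v. v \<in> S \<Longrightarrow> \<alpha> \<noteq> v + a + s"
        using assms(3) add by (fastforce simp: Apery_iff)+
      then show ?thesis using 3 shift[of \<alpha>] by simp
    next
      case 4
      \<comment> \<open>Cancelling \<open>s\<close> leaves \<open>\<beta> \<noteq> 0\<close> and
        \<open>\<beta> \<noteq> v + a\<close>.\<close>
      then show ?thesis using shift[of "\<beta> + s"] assms add by (auto simp: Apery_iff)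
    qed
  qed
qed

end
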